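(* Let $A$ and $B$ be integral domains, $f:A\to B$ a ring homomorphism and $J$ an ideal of $B$. (1) Assume that $f$ is injective. - If $J=B$, then $A\bowtie^f J$ is an elementary divisor ring if and only if both $A$ and $B$ are elementary divisor rings. - If $J\neq B$, then $A\bowtie^f J$ is an elementary divisor ring if and only if $f(A)+J$ is an elementary divisor ring and $f(A)\cap J=0$. (2) Assume that $f$ is not injective. Then $A\bowtie^f J$ is an elementary divisor ring if and only if one of the following conditions holds: - $J=0$ and $A$ is an elementary divisor ring; - $J=B$ and both $A$ and $B$ are elementary divisor rings.
   Context: All rings are commutative with identity, and ring homomorphisms preserve the identity. For a ring homomorphism $f:A\to B$ and an ideal $J$ of $B$, the amalgamation of $A$ with $B$ along $J$ with respect to $f$ is the subring $A\bowtie^f J=\{(a,f(a)+j) : a\in A,\ j\in J\}$ of $A\times B$. Here $f(A)+J=\{f(a)+j : a\in A,\ j\in J\}$, which is a subring of $B$. A ring $R$ is an elementary divisor ring if for every matrix $M$ over $R$ there exist non-singular (i.e. invertible over $R$) square matrices $P,Q$ over $R$ of appropriate sizes such that $PMQ$ is a diagonal matrix. *)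

theory Defs
  imports
    "HOL-Algebra.Chinese_Remainder"
    "Jordan_Normal_Form.Matrix"
begin

text \<open>
  Matrices are the extensional matrices of type \<open>'a mat\<close>. Their library operations use the
  type-class arithmetic of \<open>'a\<close>, so the product, the identity, invertibility and diagonality
  are defined here relative to a ring given by a record.
\<close>

definition matrices :: "('a, 'm) ring_scheme \<Rightarrow> nat \<Rightarrow> nat \<Rightarrow> 'a mat set"
  where "matrices R m n = {M \<in> carrier_mat m n. elements_mat M \<subseteq> carrier R}"

definition matrix_mult :: "('a, 'm) ring_scheme \<Rightarrow> 'a mat \<Rightarrow> 'a mat \<Rightarrow> 'a mat"
  where "matrix_mult R M N =
    mat (dim_row M) (dim_col N)
      (\<lambda>(i, j). \<Oplus>\<^bsub>R\<^esub>k\<in>{..<dim_col M}. M $$ (i, k) \<otimes>\<^bsub>R\<^esub> N $$ (k, j))"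

definition matrix_one :: "('a, 'm) ring_scheme \<Rightarrow> nat \<Rightarrow> 'a mat"
  where "matrix_one R n = mat n n (\<lambda>(i, j). if i = j then \<one>\<^bsub>R\<^esub> else \<zero>\<^bsub>R\<^esub>)"

definition invertible_matrices :: "('a, 'm) ring_scheme \<Rightarrow> nat \<Rightarrow> 'a mat set"
  where "invertible_matrices R n =
    {P \<in> matrices R n n. \<exists>P' \<in> matrices R n n.
      matrix_mult R P P' = matrix_one R n \<and> matrix_mult R P' P = matrix_one R n}"

text \<open>Diagonal matrices need not be square.\<close>

definition diagonal_matrix :: "('a, 'm) ring_scheme \<Rightarrow> 'a mat \<Rightarrow> bool"
  where "diagonal_matrix R D \<longleftrightarrow>
    (\<forall>i < dim_row D. \<forall>j < dim_col D. i \<noteq> j \<longrightarrow> D $$ (i, j) = \<zero>\<^bsub>R\<^esub>)"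

text \<open>No divisibility relation between successive diagonal entries is required.\<close>

definition elementary_divisor_ring :: "('a, 'm) ring_scheme \<Rightarrow> bool"
  where "elementary_divisor_ring R \<longleftrightarrow> cring R \<and>
    (\<forall>m n. \<forall>M \<in> matrices R m n.
      \<exists>P \<in> invertible_matrices R m. \<exists>Q \<in> invertible_matrices R n.
        diagonal_matrix R (matrix_mult R (matrix_mult R P M) Q))"

definition amalgamation ::
    "('a, 'm) ring_scheme \<Rightarrow> ('b, 'n) ring_scheme \<Rightarrow> ('a \<Rightarrow> 'b) \<Rightarrow> 'b set \<Rightarrow> ('a \<times> 'b) ring"
  where "amalgamation A B f J =
    (RDirProd A B)\<lparr>carrier := {(a, f a \<oplus>\<^bsub>B\<^esub> j) | a j. a \<in> carrier A \<and> j \<in> J}\<rparr>"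

text \<open>The ring \<open>f(A) + J\<close>, with the operations of \<open>B\<close>.\<close>

definition image_plus_ideal ::
    "('a, 'm) ring_scheme \<Rightarrow> ('b, 'n) ring_scheme \<Rightarrow> ('a \<Rightarrow> 'b) \<Rightarrow> 'b set \<Rightarrow> ('b, 'n) ring_scheme"
  where "image_plus_ideal A B f J = B\<lparr>carrier := f ` carrier A <+>\<^bsub>B\<^esub> J\<rparr>"

end

theory Submission
  imports Defs "HOL-Algebra.Subrings" "HOL-Algebra.UnivPoly"
begin

text \<open>
  If \<open>a \<noteq> 0\<close> with \<open>f a \<in> J\<close> and \<open>0 \<noteq> b \<in> J\<close>, then \<open>(a, 0)\<close> and \<open>(0, b)\<close> lie in the amalgamation, and a
  common generator \<open>(c, d)\<close> of the ideal they span has \<open>(a, 0) = (c, d) (u, 0)\<close> with \<open>u\<close> a unit and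
  \<open>f u \<in> J\<close>, so \<open>J = B\<close>. An elementary divisor ring is Bezout; hence, unless \<open>J = B\<close>, the amalgamation
  can be one only if \<open>J = 0\<close> or \<open>f\<^sup>-\<^sup>1(J) = 0\<close>. In these cases it is isomorphic to \<open>A\<close> or \<open>f(A) + J\<close>,
  and for \<open>J = B\<close> it is \<open>A \<times> B\<close>.
\<close>

section \<open>Matrices and ring homomorphisms\<close>

lemma matrices_iff:
  "M \<in> matrices R m n \<longleftrightarrow>
    M \<in> carrier_mat m n \<and> (\<forall>i<m. \<forall>j<n. M $$ (i, j) \<in> carrier R)"
proof
  assume "M \<in> matrices R m n"
  then show "M \<in> carrier_mat m n \<and> (\<forall>i<m. \<forall>j<n. M $$ (i, j) \<in> carrier R)"
    unfolding matrices_def by (metis (mono_tags, lifting) elements_matI mem_Collect_eq subsetD)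
next
  assume "M \<in> carrier_mat m n \<and> (\<forall>i<m. \<forall>j<n. M $$ (i, j) \<in> carrier R)"
  then show "M \<in> matrices R m n"
    unfolding matrices_def by auto
qed

lemma matrix_mult_closed:
  assumes "ring R" "M \<in> matrices R m n" "N \<in> matrices R n k"
  shows "matrix_mult R M N \<in> matrices R m k"
proof -
  interpret ring R by fact
  from assms(2,3) show ?thesis
    by (auto simp: matrices_iff matrix_mult_def intro!: finsum_closed)
qed

lemma map_mat_matrices:
  "h \<in> carrier R \<rightarrow> carrier S \<Longrightarrow> M \<in> matrices R m n \<Longrightarrow> map_mat h M \<in> matrices S m n"
  by (auto simp: matrices_iff)

context ring_hom_ring
begin

text \<open>An entry of the product is a finite sum of products, and \<open>h\<close> preserves
  both. All transport of diagonalizations between rings rests on this.\<close>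

lemma map_mat_matrix_mult:
  assumes "M \<in> matrices R m n" "N \<in> matrices R n k"
  shows "map_mat h (matrix_mult R M N) = matrix_mult S (map_mat h M) (map_mat h N)"
proof (rule eq_matI)
  fix i j
  assume "i < dim_row (matrix_mult S (map_mat h M) (map_mat h N))"
    and "j < dim_col (matrix_mult S (map_mat h M) (map_mat h N))"
  then have ij: "i < m" "j < k"
    using assms by (auto simp: matrix_mult_def matrices_iff)
  have entries: "(\<lambda>l. M $$ (i, l) \<otimes>\<^bsub>R\<^esub> N $$ (l, j)) \<in> {..<n} \<rightarrow> carrier R"
    using assms ij by (auto simp: matrices_iff)
  have "h (\<Oplus>\<^bsub>R\<^esub>l\<in>{..<n}. M $$ (i, l) \<otimes>\<^bsub>R\<^esub> N $$ (l, j))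
      = (\<Oplus>\<^bsub>S\<^esub>l\<in>{..<n}. h (M $$ (i, l) \<otimes>\<^bsub>R\<^esub> N $$ (l, j)))"
    using entries by (simp add: hom_finsum comp_def)
  also have "\<dots> = (\<Oplus>\<^bsub>S\<^esub>l\<in>{..<n}. h (M $$ (i, l)) \<otimes>\<^bsub>S\<^esub> h (N $$ (l, j)))"
    by (rule S.finsum_cong') (use assms ij in \<open>auto simp: matrices_iff\<close>)
  \<comment> \<open>Entries of \<open>map_mat\<close> are determined only inside the dimensions, so
    the bounds on \<open>i\<close>, \<open>j\<close> and \<open>l\<close> enter here.\<close>
  also have "\<dots> = (\<Oplus>\<^bsub>S\<^esub>l\<in>{..<n}. map_mat h M $$ (i, l) \<otimes>\<^bsub>S\<^esub> map_mat h N $$ (l, j))"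
    by (rule S.finsum_cong') (use assms ij in \<open>auto simp: matrices_iff\<close>)
  finally show "map_mat h (matrix_mult R M N) $$ (i, j)
      = matrix_mult S (map_mat h M) (map_mat h N) $$ (i, j)"
    using assms ij by (auto simp: matrix_mult_def matrices_iff)
qed (use assms in \<open>auto simp: matrix_mult_def matrices_iff\<close>)

lemma map_mat_matrix_one: "map_mat h (matrix_one R n) = matrix_one S n"
  by (rule eq_matI) (auto simp: matrix_one_def)

lemma map_mat_invertible:
  assumes "P \<in> invertible_matrices R n"
  shows "map_mat h P \<in> invertible_matrices S n"
proof -
  from assms obtain P' where P: "P \<in> matrices R n n" "P' \<in> matrices R n n"
    and inv: "matrix_mult R P P' = matrix_one R n" "matrix_mult R P' P = matrix_one R n"
    unfolding invertible_matrices_def by blast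
  have h: "h \<in> carrier R \<rightarrow> carrier S"
    by auto
  have "matrix_mult S (map_mat h P) (map_mat h P') = matrix_one S n"
    "matrix_mult S (map_mat h P') (map_mat h P) = matrix_one S n"
    using map_mat_matrix_mult[OF P] map_mat_matrix_mult[OF P(2,1)] inv map_mat_matrix_one by simp_all
  then show ?thesis
    unfolding invertible_matrices_def using map_mat_matrices[OF h] P by blast
qed

lemma diagonal_matrix_map_mat: "diagonal_matrix R D \<Longrightarrow> diagonal_matrix S (map_mat h D)"
  by (auto simp: diagonal_matrix_def)

end

section \<open>Elementary divisor rings\<close>

text \<open>Lift a matrix over \<open>S\<close> to \<open>R\<close>, diagonalize the lift, and push
  the two factors and the diagonal result forward along \<open>h\<close>.\<close>

lemma elementary_divisor_ring_surj_hom: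
  assumes R: "elementary_divisor_ring R" and S: "cring S"
    and h: "h \<in> Ring.ring_hom R S" and surj: "h ` carrier R = carrier S"
  shows "elementary_divisor_ring S"
proof -
  have "cring R"
    using R by (simp add: elementary_divisor_ring_def)
  then interpret ring_hom_ring R S h
    using S h by (intro ring_hom_ringI2 cring.axioms)
  have "\<exists>P\<in>invertible_matrices S m. \<exists>Q\<in>invertible_matrices S n.
      diagonal_matrix S (matrix_mult S (matrix_mult S P M) Q)"
    if M: "M \<in> matrices S m n" for m n M
  proof -
    \<comment> \<open>An entrywise choice of preimages. The chosen section need not be additive or
      multiplicative: it only has to produce a matrix over \<open>R\<close> that \<open>h\<close>
      maps to \<open>M\<close>.\<close>
    let ?N = "map_mat (inv_into (carrier R) h) M"
    have N: "?N \<in> matrices R m n"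
      by (rule map_mat_matrices[OF _ M]) (auto simp: surj[symmetric] intro: inv_into_into)
    have hN: "map_mat h ?N = M"
      by (rule eq_matI) (use M surj in \<open>auto simp: matrices_iff f_inv_into_f\<close>)
    obtain P Q where PQ: "P \<in> invertible_matrices R m" "Q \<in> invertible_matrices R n"
      and D: "diagonal_matrix R (matrix_mult R (matrix_mult R P ?N) Q)"
      using R N unfolding elementary_divisor_ring_def by blast
    have P: "P \<in> matrices R m m" and Q: "Q \<in> matrices R n n"
      using PQ unfolding invertible_matrices_def by auto
    have "map_mat h (matrix_mult R (matrix_mult R P ?N) Q)
        = matrix_mult S (matrix_mult S (map_mat h P) M) (map_mat h Q)"
      using map_mat_matrix_mult[OF matrix_mult_closed[OF R.ring_axioms P N] Q]
        map_mat_matrix_mult[OF P N] hN by simp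
    then show ?thesis
      using diagonal_matrix_map_mat[OF D] map_mat_invertible PQ by metis
  qed
  then show ?thesis
    unfolding elementary_divisor_ring_def using S by blast
qed

text \<open>An isomorphism and its inverse are both surjective homomorphisms.\<close>

lemma elementary_divisor_ring_iso_iff:
  assumes R: "cring R" and S: "cring S" and h: "h \<in> ring_iso R S"
  shows "elementary_divisor_ring R \<longleftrightarrow> elementary_divisor_ring S"
proof
  assume "elementary_divisor_ring R"
  then show "elementary_divisor_ring S"
    using h by (intro elementary_divisor_ring_surj_hom[OF _ S, of R h])
      (auto simp: ring_iso_def bij_betw_def)
next
  assume "elementary_divisor_ring S"
  moreover have "inv_into (carrier R) h \<in> ring_iso S R"
    using ring_iso_set_sym[OF cring.axioms(1)[OF R] h] .
  ultimately show "elementary_divisor_ring R"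
    by (intro elementary_divisor_ring_surj_hom[OF _ R, of S "inv_into (carrier R) h"])
      (auto simp: ring_iso_def bij_betw_def)
qed

section \<open>Direct products of two rings\<close>

lemma RDirProd_simps:
  "carrier (RDirProd R S) = carrier R \<times> carrier S"
  "x \<otimes>\<^bsub>RDirProd R S\<^esub> y = (fst x \<otimes>\<^bsub>R\<^esub> fst y, snd x \<otimes>\<^bsub>S\<^esub> snd y)"
  "x \<oplus>\<^bsub>RDirProd R S\<^esub> y = (fst x \<oplus>\<^bsub>R\<^esub> fst y, snd x \<oplus>\<^bsub>S\<^esub> snd y)"
  "\<one>\<^bsub>RDirProd R S\<^esub> = (\<one>\<^bsub>R\<^esub>, \<one>\<^bsub>S\<^esub>)"
  "\<zero>\<^bsub>RDirProd R S\<^esub> = (\<zero>\<^bsub>R\<^esub>, \<zero>\<^bsub>S\<^esub>)"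
  by (auto simp: RDirProd_def DirProd_def monoid.defs split: prod.splits)

lemma RDirProd_cring:
  assumes "cring R" "cring S"
  shows "cring (RDirProd R S)"
proof (intro cring.intro comm_monoid.intro comm_monoid_axioms.intro)
  show "ring (RDirProd R S)"
    using assms by (intro RDirProd_ring cring.axioms)
  then show "monoid (RDirProd R S)"
    by (simp add: ring_def)
qed (use assms in \<open>auto simp: RDirProd_simps cring.cring_simprules\<close>)

lemma RDirProd_minus:
  assumes "ring R" "ring S" "x \<in> carrier R" "y \<in> carrier S"
  shows "\<ominus>\<^bsub>RDirProd R S\<^esub> (x, y) = (\<ominus>\<^bsub>R\<^esub> x, \<ominus>\<^bsub>S\<^esub> y)"
proof -
  interpret ring "RDirProd R S"
    by (rule RDirProd_ring) fact+
  show ?thesis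
    by (rule minus_equality) (use assms in \<open>auto simp: RDirProd_simps ring.ring_simprules\<close>)
qed

lemma fst_hom: "fst \<in> Ring.ring_hom (RDirProd R S) R"
  and snd_hom: "snd \<in> Ring.ring_hom (RDirProd R S) S"
  by (auto simp: Ring.ring_hom_def RDirProd_simps)

text \<open>The inverse of splitting a matrix over a product ring into its two coordinate matrices.
  The dimensions are read off from \<open>M\<close> alone, so it is used for matrices of equal
  size.\<close>

definition pair_mat :: "'a mat \<Rightarrow> 'b mat \<Rightarrow> ('a \<times> 'b) mat"
  where "pair_mat M N = mat (dim_row M) (dim_col M) (\<lambda>ij. (M $$ ij, N $$ ij))"

lemma pair_mat_matrices:
  "M \<in> matrices R m n \<Longrightarrow> N \<in> matrices S m n \<Longrightarrow> pair_mat M N \<in> matrices (RDirProd R S) m n"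
  by (auto simp: matrices_iff pair_mat_def RDirProd_simps)

lemma map_mat_pair_mat:
  assumes "M \<in> carrier_mat m n" "N \<in> carrier_mat m n"
  shows "map_mat fst (pair_mat M N) = M" "map_mat snd (pair_mat M N) = N"
  using assms by (auto simp: pair_mat_def)

text \<open>Reduces an identity over a product ring to its two coordinates, where \<open>fst\<close>
  and \<open>snd\<close> act as ring homomorphisms.\<close>

lemma mat_eq_pairI:
  assumes fst: "map_mat fst M = map_mat fst N" and snd: "map_mat snd M = map_mat snd N"
  shows "M = N"
proof (rule eq_matI)
  show dims: "dim_row M = dim_row N" "dim_col M = dim_col N"
    using arg_cong[OF fst, of dim_row] arg_cong[OF fst, of dim_col] by simp_all
  fix i j
  assume "i < dim_row N" "j < dim_col N"
  then show "M $$ (i, j) = N $$ (i, j)"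
    using arg_cong[OF fst, of "\<lambda>X. X $$ (i, j)"] arg_cong[OF snd, of "\<lambda>X. X $$ (i, j)"] dims
    by (simp add: prod_eq_iff)
qed

lemma pair_mat_invertible:
  assumes R: "ring R" and S: "ring S"
    and M: "M \<in> invertible_matrices R n" and N: "N \<in> invertible_matrices S n"
  shows "pair_mat M N \<in> invertible_matrices (RDirProd R S) n"
proof -
  interpret fst: ring_hom_ring "RDirProd R S" R fst
    using R S by (intro ring_hom_ringI2 RDirProd_ring fst_hom)
  interpret snd: ring_hom_ring "RDirProd R S" S snd
    using R S by (intro ring_hom_ringI2 RDirProd_ring snd_hom)
  \<comment> \<open>Stated for arbitrary one-sided inverses, so that it covers both orders of
    multiplication.\<close>
  have inverse: "matrix_mult (RDirProd R S) (pair_mat X Y) (pair_mat X' Y') = matrix_one (RDirProd R S) n"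
    if X: "X \<in> matrices R n n" "X' \<in> matrices R n n" "matrix_mult R X X' = matrix_one R n"
      and Y: "Y \<in> matrices S n n" "Y' \<in> matrices S n n" "matrix_mult S Y Y' = matrix_one S n"
    for X Y X' Y'
  proof (rule mat_eq_pairI)
    have mats: "X \<in> carrier_mat n n" "X' \<in> carrier_mat n n" "Y \<in> carrier_mat n n" "Y' \<in> carrier_mat n n"
      using X Y by (auto simp: matrices_iff)
    note pairs = pair_mat_matrices[OF X(1) Y(1)] pair_mat_matrices[OF X(2) Y(2)]
    show "map_mat fst (matrix_mult (RDirProd R S) (pair_mat X Y) (pair_mat X' Y'))
        = map_mat fst (matrix_one (RDirProd R S) n)"
      unfolding fst.map_mat_matrix_mult[OF pairs] fst.map_mat_matrix_one
      by (simp add: map_mat_pair_mat[OF mats(1,3)] map_mat_pair_mat[OF mats(2,4)] X)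
    show "map_mat snd (matrix_mult (RDirProd R S) (pair_mat X Y) (pair_mat X' Y'))
        = map_mat snd (matrix_one (RDirProd R S) n)"
      unfolding snd.map_mat_matrix_mult[OF pairs] snd.map_mat_matrix_one
      by (simp add: map_mat_pair_mat[OF mats(1,3)] map_mat_pair_mat[OF mats(2,4)] Y)
  qed
  obtain M' where "M \<in> matrices R n n" "M' \<in> matrices R n n"
    "matrix_mult R M M' = matrix_one R n" "matrix_mult R M' M = matrix_one R n"
    using M unfolding invertible_matrices_def by blast
  moreover obtain N' where "N \<in> matrices S n n" "N' \<in> matrices S n n"
    "matrix_mult S N N' = matrix_one S n" "matrix_mult S N' N = matrix_one S n"
    using N unfolding invertible_matrices_def by blast
  ultimately have "pair_mat M N \<in> matrices (RDirProd R S) n n"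
    "pair_mat M' N' \<in> matrices (RDirProd R S) n n"
    "matrix_mult (RDirProd R S) (pair_mat M N) (pair_mat M' N') = matrix_one (RDirProd R S) n"
    "matrix_mult (RDirProd R S) (pair_mat M' N') (pair_mat M N) = matrix_one (RDirProd R S) n"
    by (simp_all add: inverse pair_mat_matrices)
  then show ?thesis
    unfolding invertible_matrices_def by blast
qed

text \<open>A matrix over the product is diagonal as soon as both of its coordinate matrices are.
  The factors can therefore be found independently over \<open>R\<close> and \<open>S\<close> and
  then paired.\<close>

lemma elementary_divisor_ring_RDirProd:
  assumes R: "elementary_divisor_ring R" and S: "elementary_divisor_ring S"
  shows "elementary_divisor_ring (RDirProd R S)"
proof -
  have crings: "cring R" "cring S"
    using R S by (simp_all add: elementary_divisor_ring_def)
  have rings: "ring R" "ring S"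
    using crings by (simp_all add: cring.axioms)
  interpret fst: ring_hom_ring "RDirProd R S" R fst
    using rings by (intro ring_hom_ringI2 RDirProd_ring fst_hom)
  interpret snd: ring_hom_ring "RDirProd R S" S snd
    using rings by (intro ring_hom_ringI2 RDirProd_ring snd_hom)
  have "\<exists>P\<in>invertible_matrices (RDirProd R S) m. \<exists>Q\<in>invertible_matrices (RDirProd R S) n.
      diagonal_matrix (RDirProd R S) (matrix_mult (RDirProd R S) (matrix_mult (RDirProd R S) P M) Q)"
    if M: "M \<in> matrices (RDirProd R S) m n" for m n M
  proof -
    have "map_mat fst M \<in> matrices R m n"
      by (rule map_mat_matrices[OF _ M]) auto
    then obtain P1 Q1 where PQ1: "P1 \<in> invertible_matrices R m" "Q1 \<in> invertible_matrices R n"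
      and D1: "diagonal_matrix R (matrix_mult R (matrix_mult R P1 (map_mat fst M)) Q1)"
      using R unfolding elementary_divisor_ring_def by blast
    have "map_mat snd M \<in> matrices S m n"
      by (rule map_mat_matrices[OF _ M]) auto
    then obtain P2 Q2 where PQ2: "P2 \<in> invertible_matrices S m" "Q2 \<in> invertible_matrices S n"
      and D2: "diagonal_matrix S (matrix_mult S (matrix_mult S P2 (map_mat snd M)) Q2)"
      using S unfolding elementary_divisor_ring_def by blast
    define P where "P = pair_mat P1 P2"
    define Q where "Q = pair_mat Q1 Q2"
    define D where "D = matrix_mult (RDirProd R S) (matrix_mult (RDirProd R S) P M) Q"
    have inv: "P \<in> invertible_matrices (RDirProd R S) m" "Q \<in> invertible_matrices (RDirProd R S) n"
      using PQ1 PQ2 rings by (simp_all add: P_def Q_def pair_mat_invertible)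
    then have PQ: "P \<in> matrices (RDirProd R S) m m" "Q \<in> matrices (RDirProd R S) n n"
      by (auto simp: invertible_matrices_def)
    have P_maps: "map_mat fst P = P1" "map_mat snd P = P2"
      unfolding P_def using PQ1 PQ2
      by (auto intro!: map_mat_pair_mat[of _ m m] simp: invertible_matrices_def matrices_iff)
    have Q_maps: "map_mat fst Q = Q1" "map_mat snd Q = Q2"
      unfolding Q_def using PQ1 PQ2
      by (auto intro!: map_mat_pair_mat[of _ n n] simp: invertible_matrices_def matrices_iff)
    note PM = matrix_mult_closed[OF fst.R.ring_axioms PQ(1) M]
    have "diagonal_matrix R (map_mat fst D)"
      unfolding D_def fst.map_mat_matrix_mult[OF PM PQ(2)] fst.map_mat_matrix_mult[OF PQ(1) M]
        P_maps Q_maps by (fact D1)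
    moreover have "diagonal_matrix S (map_mat snd D)"
      unfolding D_def snd.map_mat_matrix_mult[OF PM PQ(2)] snd.map_mat_matrix_mult[OF PQ(1) M]
        P_maps Q_maps by (fact D2)
    ultimately have "diagonal_matrix (RDirProd R S) D"
      by (simp add: diagonal_matrix_def RDirProd_simps prod_eq_iff)
    then show ?thesis
      unfolding D_def using inv by blast
  qed
  then show ?thesis
    unfolding elementary_divisor_ring_def using RDirProd_cring[OF crings] by blast
qed

lemma elementary_divisor_ring_RDirProd_iff:
  assumes "cring R" "cring S"
  shows "elementary_divisor_ring (RDirProd R S) \<longleftrightarrow>
    elementary_divisor_ring R \<and> elementary_divisor_ring S"
proof (intro iffI conjI)
  assume RS: "elementary_divisor_ring (RDirProd R S)"
  \<comment> \<open>Each factor is nonempty, which makes the projection onto the other one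
    surjective.\<close>
  have "\<zero>\<^bsub>R\<^esub> \<in> carrier R" "\<zero>\<^bsub>S\<^esub> \<in> carrier S"
    using assms by (simp_all add: cring.cring_simprules)
  then have "fst ` carrier (RDirProd R S) = carrier R" "snd ` carrier (RDirProd R S) = carrier S"
    by (auto simp: RDirProd_simps)
  then show "elementary_divisor_ring R" "elementary_divisor_ring S"
    using elementary_divisor_ring_surj_hom[OF RS assms(1) fst_hom]
      elementary_divisor_ring_surj_hom[OF RS assms(2) snd_hom] by simp_all
qed (simp add: elementary_divisor_ring_RDirProd)

section \<open>The Bezout property of elementary divisor rings\<close>

text \<open>
  Reducing the row \<open>(x, y)\<close> to \<open>(d, 0)\<close>: \<open>p\<close> is the entry of the left factor, and the inverse of the right
  factor expresses \<open>p x\<close> and \<open>p y\<close> as multiples of \<open>d\<close>.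
\<close>

lemma elementary_divisor_ring_bezout:
  fixes R :: "('a, 'm) ring_scheme" (structure)
  assumes R: "elementary_divisor_ring R" and x: "x \<in> carrier R" and y: "y \<in> carrier R"
  obtains d u v r s where "d \<in> carrier R" "u \<in> carrier R" "v \<in> carrier R" "r \<in> carrier R" "s \<in> carrier R"
    "x = d \<otimes> u" "y = d \<otimes> v" "d = x \<otimes> r \<oplus> y \<otimes> s"
proof -
  interpret cring R
    using R by (simp add: elementary_divisor_ring_def)
  define M where "M = mat 1 2 (\<lambda>(i, j). if j = (0::nat) then x else y)"
  have "M \<in> matrices R 1 2"
    using x y by (auto simp: M_def matrices_iff)
  then obtain P Q where PQ: "P \<in> invertible_matrices R 1" "Q \<in> invertible_matrices R 2"
    and diag: "diagonal_matrix R (matrix_mult R (matrix_mult R P M) Q)"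
    using R unfolding elementary_divisor_ring_def by blast
  obtain P' where P: "P \<in> matrices R 1 1" "P' \<in> matrices R 1 1"
    and P'P: "matrix_mult R P' P = matrix_one R 1"
    using PQ(1) unfolding invertible_matrices_def by blast
  obtain Q' where Q: "Q \<in> matrices R 2 2" "Q' \<in> matrices R 2 2"
    and QQ': "matrix_mult R Q Q' = matrix_one R 2"
    using PQ(2) unfolding invertible_matrices_def by blast
  have two: "{..<2} = {0, Suc 0}"
    by auto
  have dims: "dim_row P = 1" "dim_col P = 1" "dim_row P' = 1" "dim_col P' = 1"
      "dim_row Q = 2" "dim_col Q = 2" "dim_row Q' = 2" "dim_col Q' = 2"
    using P Q by (auto simp: matrices_iff)
  define p p' where "p = P $$ (0, 0)" and "p' = P' $$ (0, 0)"
  define q where "q i j = Q $$ (i, j)" for i j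
  define q' where "q' i j = Q' $$ (i, j)" for i j
  have p: "p \<in> carrier R" "p' \<in> carrier R"
    using P by (auto simp: p_def p'_def matrices_iff)
  have q: "q 0 0 \<in> carrier R" "q 0 1 \<in> carrier R" "q 1 0 \<in> carrier R" "q 1 1 \<in> carrier R"
    and q': "q' 0 0 \<in> carrier R" "q' 0 1 \<in> carrier R" "q' 1 0 \<in> carrier R" "q' 1 1 \<in> carrier R"
    using Q by (auto simp: q_def q'_def matrices_iff)
  \<comment> \<open>A 1 by 1 invertible matrix is a unit, so \<open>p\<close> can be cancelled at
    the end.\<close>
  have p'p: "p' \<otimes> p = \<one>"
    using arg_cong[OF P'P, of "\<lambda>X. X $$ (0, 0)"] p
    by (simp add: matrix_mult_def matrix_one_def dims lessThan_Suc p_def p'_def)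
  have qq': "q i 0 \<otimes> q' 0 j \<oplus> q i 1 \<otimes> q' 1 j = (if i = j then \<one> else \<zero>)" if "i < 2" "j < 2" for i j
    using arg_cong[OF QQ', of "\<lambda>X. X $$ (i, j)"] Q that
    by (auto simp: matrix_mult_def matrix_one_def matrices_iff dims q_def q'_def two less_2_cases_iff)
  \<comment> \<open>The entry at position (0, 0) of the diagonalized row; the entry at (0, 1) is off
    the diagonal and hence zero.\<close>
  define d where "d = p \<otimes> x \<otimes> q 0 0 \<oplus> p \<otimes> y \<otimes> q 1 0"
  have zero: "p \<otimes> x \<otimes> q 0 1 \<oplus> p \<otimes> y \<otimes> q 1 1 = \<zero>"
  proof -
    have "matrix_mult R (matrix_mult R P M) Q $$ (0, 1) = \<zero>"
      using diag by (simp add: diagonal_matrix_def matrix_mult_def dims)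
    then show ?thesis
      using p q x y by (simp add: matrix_mult_def M_def dims lessThan_Suc two p_def q_def)
  qed
  \<comment> \<open>For a column \<open>c\<close> and \<open>e\<close> equal to \<open>Q\<close>
    times \<open>c\<close>, apply the row \<open>P M Q\<close> to \<open>c\<close>: this is
    \<open>p\<close> times the value of \<open>(x, y)\<close> at \<open>e\<close>, and also
    \<open>d \<otimes> c0\<close>, because the second entry of the row vanishes. Taking
    \<open>c\<close> to be a column of \<open>Q'\<close> turns \<open>e\<close> into a standard
    basis vector, which isolates \<open>x\<close> or \<open>y\<close>.\<close>
  have multiple: "p \<otimes> (x \<otimes> e0 \<oplus> y \<otimes> e1) = d \<otimes> c0"
    if c: "c0 \<in> carrier R" "c1 \<in> carrier R"
      and e: "e0 = q 0 0 \<otimes> c0 \<oplus> q 0 1 \<otimes> c1" "e1 = q 1 0 \<otimes> c0 \<oplus> q 1 1 \<otimes> c1" for c0 c1 e0 e1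
  proof -
    have "p \<otimes> (x \<otimes> e0 \<oplus> y \<otimes> e1)
        = d \<otimes> c0 \<oplus> (p \<otimes> x \<otimes> q 0 1 \<oplus> p \<otimes> y \<otimes> q 1 1) \<otimes> c1"
      unfolding d_def e using c p q x y by algebra
    also have "\<dots> = d \<otimes> c0"
      unfolding zero d_def using c p q x y by simp
    finally show ?thesis .
  qed
  have px: "p \<otimes> x = d \<otimes> q' 0 0"
    using multiple[of "q' 0 0" "q' 1 0" \<one> \<zero>] qq'[of 0 0] qq'[of 1 0] q' x y by simp
  have py: "p \<otimes> y = d \<otimes> q' 0 1"
    using multiple[of "q' 0 1" "q' 1 1" \<zero> \<one>] qq'[of 0 1] qq'[of 1 1] q' x y by simp
  have d: "d \<in> carrier R"
    unfolding d_def using p q x y by simp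
  \<comment> \<open>Multiplying by \<open>p'\<close> turns divisibility of
    \<open>p \<otimes> z\<close> by \<open>d\<close> into divisibility of \<open>z\<close> by
    \<open>d\<close>.\<close>
  have cancel: "z = d \<otimes> (p' \<otimes> c)"
    if "z \<in> carrier R" "c \<in> carrier R" "p \<otimes> z = d \<otimes> c" for z c
  proof -
    have "z = p' \<otimes> p \<otimes> z"
      using that(1) p'p by simp
    also have "\<dots> = p' \<otimes> (d \<otimes> c)"
      using that p by (simp add: m_assoc)
    also have "\<dots> = d \<otimes> (p' \<otimes> c)"
      using that(2) p d by algebra
    finally show ?thesis .
  qed
  show thesis
  proof (rule that)
    show "x = d \<otimes> (p' \<otimes> q' 0 0)" "y = d \<otimes> (p' \<otimes> q' 0 1)"
      using cancel px py x y q' by auto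
    show "d = x \<otimes> (p \<otimes> q 0 0) \<oplus> y \<otimes> (p \<otimes> q 1 0)"
      unfolding d_def using p q x y by algebra
  qed (use d p q q' in auto)
qed

section \<open>Amalgamations\<close>

locale amalgamation_data =
  A: cring A + B: cring B + ring_hom_cring A B f + J: ideal J B
  for A :: "('a, 'm) ring_scheme" and B :: "('b, 'n) ring_scheme"
    and f :: "'a \<Rightarrow> 'b" and J :: "'b set"
begin

abbreviation amalg :: "('a \<times> 'b) ring"
  where "amalg \<equiv> amalgamation A B f J"

lemma amalg_simps:
  "x \<otimes>\<^bsub>amalg\<^esub> y = (fst x \<otimes>\<^bsub>A\<^esub> fst y, snd x \<otimes>\<^bsub>B\<^esub> snd y)"
  "x \<oplus>\<^bsub>amalg\<^esub> y = (fst x \<oplus>\<^bsub>A\<^esub> fst y, snd x \<oplus>\<^bsub>B\<^esub> snd y)"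
  "\<one>\<^bsub>amalg\<^esub> = (\<one>\<^bsub>A\<^esub>, \<one>\<^bsub>B\<^esub>)"
  "\<zero>\<^bsub>amalg\<^esub> = (\<zero>\<^bsub>A\<^esub>, \<zero>\<^bsub>B\<^esub>)"
  by (simp_all add: amalgamation_def RDirProd_simps)

lemma mem_amalg_iff:
  "(a, b) \<in> carrier amalg \<longleftrightarrow> a \<in> carrier A \<and> b \<in> carrier B \<and> b \<ominus>\<^bsub>B\<^esub> f a \<in> J"
proof
  assume "(a, b) \<in> carrier amalg"
  then obtain j where j: "a \<in> carrier A" "j \<in> J" "b = f a \<oplus>\<^bsub>B\<^esub> j"
    by (auto simp: amalgamation_def)
  have "j \<in> carrier B" "f a \<in> carrier B"
    using j by auto
  then have "f a \<oplus>\<^bsub>B\<^esub> j \<ominus>\<^bsub>B\<^esub> f a = j"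
    by algebra
  with j show "a \<in> carrier A \<and> b \<in> carrier B \<and> b \<ominus>\<^bsub>B\<^esub> f a \<in> J"
    using \<open>j \<in> carrier B\<close> by simp
next
  assume b: "a \<in> carrier A \<and> b \<in> carrier B \<and> b \<ominus>\<^bsub>B\<^esub> f a \<in> J"
  then have "f a \<in> carrier B" "b \<in> carrier B"
    by auto
  then have "b = f a \<oplus>\<^bsub>B\<^esub> (b \<ominus>\<^bsub>B\<^esub> f a)"
    by algebra
  with b show "(a, b) \<in> carrier amalg"
    unfolding amalgamation_def by auto
qed

lemma cring_amalg: "cring amalg"
proof -
  interpret P: cring "RDirProd A B"
    by (intro RDirProd_cring A.is_cring B.is_cring)
  let ?C = "{(a, f a \<oplus>\<^bsub>B\<^esub> j) | a j. a \<in> carrier A \<and> j \<in> J}"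
  have C: "(a, b) \<in> ?C \<longleftrightarrow> a \<in> carrier A \<and> b \<in> carrier B \<and> b \<ominus>\<^bsub>B\<^esub> f a \<in> J" for a b
    using mem_amalg_iff[of a b] by (simp add: amalgamation_def)
  have sub: "subring ?C (RDirProd A B)"
  proof (rule P.subringI)
    show "?C \<subseteq> carrier (RDirProd A B)"
      by (auto simp: RDirProd_simps)
    show "\<one>\<^bsub>RDirProd A B\<^esub> \<in> ?C"
      using C[of "\<one>\<^bsub>A\<^esub>" "\<one>\<^bsub>B\<^esub>"] by (simp add: RDirProd_simps B.minus_eq B.r_neg)
    fix h assume h: "h \<in> ?C"
    obtain a b where ab: "h = (a, b)"
      by fastforce
    have hab: "a \<in> carrier A" "b \<in> carrier B" "b \<ominus>\<^bsub>B\<^esub> f a \<in> J"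
      using iffD1[OF C h[unfolded ab]] by simp_all
    then have fa: "f a \<in> carrier B"
      by simp
    have "\<ominus>\<^bsub>B\<^esub> b \<ominus>\<^bsub>B\<^esub> f (\<ominus>\<^bsub>A\<^esub> a) = \<ominus>\<^bsub>B\<^esub> (b \<ominus>\<^bsub>B\<^esub> f a)"
      using hab fa by (simp, algebra)
    then show "\<ominus>\<^bsub>RDirProd A B\<^esub> h \<in> ?C"
      unfolding ab RDirProd_minus[OF A.ring_axioms B.ring_axioms hab(1,2)] C
      using hab J.a_inv_closed by simp
    fix h' assume h': "h' \<in> ?C"
    obtain a' b' where ab': "h' = (a', b')"
      by fastforce
    have hab': "a' \<in> carrier A" "b' \<in> carrier B" "b' \<ominus>\<^bsub>B\<^esub> f a' \<in> J"
      using iffD1[OF C h'[unfolded ab']] by simp_all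
    then have fa': "f a' \<in> carrier B"
      by simp
    \<comment> \<open>The defect of a product is a combination of the defects of its factors with
      coefficients in \<open>B\<close>, so absorption by the ideal keeps it in
      \<open>J\<close>.\<close>
    have "b \<otimes>\<^bsub>B\<^esub> b' \<ominus>\<^bsub>B\<^esub> f a \<otimes>\<^bsub>B\<^esub> f a'
        = b' \<otimes>\<^bsub>B\<^esub> (b \<ominus>\<^bsub>B\<^esub> f a) \<oplus>\<^bsub>B\<^esub> f a \<otimes>\<^bsub>B\<^esub> (b' \<ominus>\<^bsub>B\<^esub> f a')"
      using hab hab' fa fa' by algebra
    moreover have "\<dots> \<in> J"
      using hab hab' fa fa' by (intro J.a_closed J.I_l_closed)
    ultimately show "h \<otimes>\<^bsub>RDirProd A B\<^esub> h' \<in> ?C"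
      unfolding ab ab' RDirProd_simps fst_conv snd_conv C using hab hab' by simp
    have "(b \<oplus>\<^bsub>B\<^esub> b') \<ominus>\<^bsub>B\<^esub> (f a \<oplus>\<^bsub>B\<^esub> f a') = (b \<ominus>\<^bsub>B\<^esub> f a) \<oplus>\<^bsub>B\<^esub> (b' \<ominus>\<^bsub>B\<^esub> f a')"
      using hab hab' fa fa' by algebra
    moreover have "\<dots> \<in> J"
      using hab hab' by (intro J.a_closed)
    ultimately show "h \<oplus>\<^bsub>RDirProd A B\<^esub> h' \<in> ?C"
      unfolding ab ab' RDirProd_simps fst_conv snd_conv C using hab hab' by simp
  qed
  show ?thesis
    unfolding amalgamation_def
    using P.subcringI'[OF sub] P.subcring_iff[OF subringE(1)[OF sub]] by simp
qed

section \<open>The two projections and the ring \<open>f(A) + J\<close>\<close>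

lemma fst_hom_amalg: "fst \<in> Ring.ring_hom amalg A"
  and snd_hom_amalg: "snd \<in> Ring.ring_hom amalg B"
  by (auto simp: Ring.ring_hom_def amalg_simps mem_amalg_iff)

lemma snd_image_amalg: "snd ` carrier amalg = carrier (image_plus_ideal A B f J)"
proof
  show "snd ` carrier amalg \<subseteq> carrier (image_plus_ideal A B f J)"
    by (auto simp: amalgamation_def image_plus_ideal_def set_add_def')
  show "carrier (image_plus_ideal A B f J) \<subseteq> snd ` carrier amalg"
    by (force simp: amalgamation_def image_plus_ideal_def set_add_def')
qed

text \<open>This ring is the image of the amalgamation under the second projection, and a
  homomorphic image of a commutative ring is one.\<close>

lemma cring_image_plus_ideal: "cring (image_plus_ideal A B f J)"
proof -
  interpret snd: ring_hom_ring amalg B snd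
    by (intro ring_hom_ringI2 cring.axioms(1) cring_amalg B.is_cring snd_hom_amalg)
  have "image_plus_ideal A B f J = B\<lparr>carrier := snd ` carrier amalg\<rparr>"
    unfolding snd_image_amalg by (simp add: image_plus_ideal_def)
  then show ?thesis
    using snd.img_is_cring[OF B.is_cring] by simp
qed

lemma snd_hom_image_plus_ideal: "snd \<in> Ring.ring_hom amalg (image_plus_ideal A B f J)"
  using snd_hom_amalg snd_image_amalg by (auto simp: Ring.ring_hom_def image_plus_ideal_def)

section \<open>Cases in which the amalgamation is a product, a copy of \<open>A\<close> or a copy of
  \<open>f(A) + J\<close>\<close>

lemma amalg_top:
  assumes "J = carrier B"
  shows "amalg = RDirProd A B"
proof -
  have "(a, b) \<in> carrier amalg \<longleftrightarrow> (a, b) \<in> carrier (RDirProd A B)" for a b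
    unfolding mem_amalg_iff by (auto simp: RDirProd_simps assms)
  then have "carrier amalg = carrier (RDirProd A B)"
    by auto
  then show ?thesis
    by (simp add: amalgamation_def)
qed

lemma elementary_divisor_ring_amalg_top_iff:
  assumes "J = carrier B"
  shows "elementary_divisor_ring amalg \<longleftrightarrow> elementary_divisor_ring A \<and> elementary_divisor_ring B"
  unfolding amalg_top[OF assms]
  using elementary_divisor_ring_RDirProd_iff A.is_cring B.is_cring .

text \<open>For zero \<open>J\<close> the amalgamation is the graph of \<open>f\<close>, which the
  first projection maps isomorphically onto \<open>A\<close>.\<close>

lemma elementary_divisor_ring_amalg_zero_iff:
  assumes J: "J = {\<zero>\<^bsub>B\<^esub>}"
  shows "elementary_divisor_ring amalg \<longleftrightarrow> elementary_divisor_ring A"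
proof (rule elementary_divisor_ring_iso_iff[OF cring_amalg A.is_cring])
  have "carrier amalg = (\<lambda>a. (a, f a)) ` carrier A"
    using J by (auto simp: amalgamation_def)
  then have "bij_betw fst (carrier amalg) (carrier A)"
    by (auto simp: bij_betw_def inj_on_def image_image)
  then show "fst \<in> ring_iso amalg A"
    using fst_hom_amalg by (simp add: ring_iso_def)
qed

text \<open>The second projection always maps onto \<open>f(A) + J\<close>, and its kernel consists
  of the pairs \<open>(a, 0)\<close> with \<open>f a\<close> in \<open>J\<close>. The two hypotheses
  together make this kernel trivial.\<close>

lemma elementary_divisor_ring_amalg_inj_iff:
  assumes inj: "inj_on f (carrier A)" and disjoint: "f ` carrier A \<inter> J = {\<zero>\<^bsub>B\<^esub>}"
  shows "elementary_divisor_ring amalg \<longleftrightarrow> elementary_divisor_ring (image_plus_ideal A B f J)"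
proof (rule elementary_divisor_ring_iso_iff[OF cring_amalg cring_image_plus_ideal])
  have "inj_on snd (carrier amalg)"
  proof (rule inj_onI, clarify)
    fix a b a' b'
    assume ab: "(a, b) \<in> carrier amalg" and ab': "(a', b') \<in> carrier amalg"
      and eq: "snd (a, b) = snd (a', b')"
    have a: "a \<in> carrier A" "b \<in> carrier B" "b \<ominus>\<^bsub>B\<^esub> f a \<in> J"
      and a': "a' \<in> carrier A" "b \<ominus>\<^bsub>B\<^esub> f a' \<in> J"
      using ab ab' eq by (auto simp: mem_amalg_iff)
    have carr: "f a \<in> carrier B" "f a' \<in> carrier B"
      using a a' by auto
    have "f (a \<ominus>\<^bsub>A\<^esub> a') = f a \<ominus>\<^bsub>B\<^esub> f a'"
      using a a' by (simp add: A.minus_eq B.minus_eq)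
    \<comment> \<open>Both points have second coordinate \<open>b\<close>, which cancels when their
      defects are subtracted.\<close>
    also have "\<dots> = (b \<ominus>\<^bsub>B\<^esub> f a') \<ominus>\<^bsub>B\<^esub> (b \<ominus>\<^bsub>B\<^esub> f a)"
      using carr a(2) by algebra
    also have "\<dots> \<in> J"
      using a(3) a'(2) by (simp add: B.minus_eq J.a_closed J.a_inv_closed)
    finally have "f (a \<ominus>\<^bsub>A\<^esub> a') \<in> J" .
    moreover have "f (a \<ominus>\<^bsub>A\<^esub> a') \<in> f ` carrier A"
      using a a' by (intro imageI) simp
    ultimately have "f (a \<ominus>\<^bsub>A\<^esub> a') \<in> f ` carrier A \<inter> J"
      by (rule IntI[rotated])
    then have "f (a \<ominus>\<^bsub>A\<^esub> a') = \<zero>\<^bsub>B\<^esub>"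
      unfolding disjoint by simp
    then have "f a \<ominus>\<^bsub>B\<^esub> f a' = \<zero>\<^bsub>B\<^esub>"
      using a a' by (simp add: A.minus_eq B.minus_eq)
    then have "f a = f a'"
      using carr by (simp add: B.r_right_minus_eq)
    then show "a = a' \<and> b = b'"
      using inj a a' eq by (simp add: inj_on_eq_iff)
  qed
  then show "snd \<in> ring_iso amalg (image_plus_ideal A B f J)"
    using snd_hom_image_plus_ideal snd_image_amalg by (simp add: ring_iso_def bij_betw_def)
qed

text \<open>The source of the restrictions on \<open>J\<close> in the theorem: it rules out a proper
  nonzero \<open>J\<close> whose preimage under \<open>f\<close> is nonzero.\<close>

lemma elementary_divisor_ring_amalg_imp_top:
  assumes "domain A" "domain B"
    and amalg: "elementary_divisor_ring amalg"
    and a: "a \<in> carrier A" "a \<noteq> \<zero>\<^bsub>A\<^esub>" "f a \<in> J" and b: "b \<in> J" "b \<noteq> \<zero>\<^bsub>B\<^esub>"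
  shows "J = carrier B"
proof -
  interpret A: domain A by fact
  interpret B: domain B by fact
  have ab: "(a, \<zero>\<^bsub>B\<^esub>) \<in> carrier amalg" "(\<zero>\<^bsub>A\<^esub>, b) \<in> carrier amalg"
    using a b by (simp_all add: mem_amalg_iff B.minus_eq J.a_inv_closed)
  obtain d u v r s where carr: "d \<in> carrier amalg" "u \<in> carrier amalg" "v \<in> carrier amalg"
      "r \<in> carrier amalg" "s \<in> carrier amalg"
    and eqs: "(a, \<zero>\<^bsub>B\<^esub>) = d \<otimes>\<^bsub>amalg\<^esub> u" "(\<zero>\<^bsub>A\<^esub>, b) = d \<otimes>\<^bsub>amalg\<^esub> v"
      "d = (a, \<zero>\<^bsub>B\<^esub>) \<otimes>\<^bsub>amalg\<^esub> r \<oplus>\<^bsub>amalg\<^esub> (\<zero>\<^bsub>A\<^esub>, b) \<otimes>\<^bsub>amalg\<^esub> s"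
    using elementary_divisor_ring_bezout[OF amalg ab] .
  obtain d1 d2 u1 u2 v1 v2 r1 r2 s1 s2 where
    pairs: "d = (d1, d2)" "u = (u1, u2)" "v = (v1, v2)" "r = (r1, r2)" "s = (s1, s2)"
    by fastforce
  have carr1: "d1 \<in> carrier A" "u1 \<in> carrier A" "r1 \<in> carrier A" "s1 \<in> carrier A"
    and carr2: "d2 \<in> carrier B" "u2 \<in> carrier B" "v2 \<in> carrier B"
    and u: "u2 \<ominus>\<^bsub>B\<^esub> f u1 \<in> J"
    using carr by (auto simp: pairs mem_amalg_iff)
  \<comment> \<open>The \<open>s\<close> term of the Bezout relation vanishes in the first
    coordinate, so \<open>a\<close> and \<open>d1\<close> divide each other.\<close>
  have d1: "a = d1 \<otimes>\<^bsub>A\<^esub> u1" "d1 = a \<otimes>\<^bsub>A\<^esub> r1"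
    using arg_cong[OF eqs(1), of fst] arg_cong[OF eqs(3), of fst] carr1 a(1)
    unfolding pairs amalg_simps by simp_all
  have d2: "\<zero>\<^bsub>B\<^esub> = d2 \<otimes>\<^bsub>B\<^esub> u2" "b = d2 \<otimes>\<^bsub>B\<^esub> v2"
    using arg_cong[OF eqs(1), of snd] arg_cong[OF eqs(2), of snd]
    unfolding pairs amalg_simps by simp_all
  \<comment> \<open>\<open>d2\<close> divides the nonzero \<open>b\<close>, so it is nonzero, and
    \<open>B\<close> has no zero divisors.\<close>
  have "u2 = \<zero>\<^bsub>B\<^esub>"
    using d2 b(2) carr2 by (metis B.integral B.l_null)
  then have "\<ominus>\<^bsub>B\<^esub> (u2 \<ominus>\<^bsub>B\<^esub> f u1) = f u1"
    using carr1(2) by (simp add: B.minus_eq)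
  then have "f u1 \<in> J"
    using J.a_inv_closed[OF u] by simp
  moreover have "u1 \<otimes>\<^bsub>A\<^esub> r1 = \<one>\<^bsub>A\<^esub>"
  proof -
    have "d1 \<noteq> \<zero>\<^bsub>A\<^esub>"
      using d1(1) a(2) carr1 by auto
    moreover have "d1 \<otimes>\<^bsub>A\<^esub> (u1 \<otimes>\<^bsub>A\<^esub> r1) = d1 \<otimes>\<^bsub>A\<^esub> \<one>\<^bsub>A\<^esub>"
      using d1 carr1 by (metis A.m_assoc A.r_one)
    ultimately show ?thesis
      using A.m_lcancel[of d1 "u1 \<otimes>\<^bsub>A\<^esub> r1" "\<one>\<^bsub>A\<^esub>"] carr1 by simp
  qed
  then have "f u1 \<otimes>\<^bsub>B\<^esub> f r1 = \<one>\<^bsub>B\<^esub>"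
    using carr1 by (metis hom_mult hom_one)
  ultimately have "\<one>\<^bsub>B\<^esub> \<in> J"
    using J.I_r_closed carr1(3) by (metis hom_closed)
  then show ?thesis
    by (rule J.one_imp_carrier)
qed

end

section \<open>The characterization over integral domains\<close>

theorem theorem2p4:
  fixes A :: "('a, 'm) ring_scheme" and B :: "('b, 'n) ring_scheme"
    and f :: "'a \<Rightarrow> 'b" and J :: "'b set"
  assumes "domain A" and "domain B"
    and "f \<in> Ring.ring_hom A B"
    and "ideal J B"
  shows "(inj_on f (carrier A) \<longrightarrow>
            (J = carrier B \<longrightarrow>
              (elementary_divisor_ring (amalgamation A B f J) \<longleftrightarrow>
                elementary_divisor_ring A \<and> elementary_divisor_ring B)) \<and>
            (J \<noteq> carrier B \<longrightarrow>
              (elementary_divisor_ring (amalgamation A B f J) \<longleftrightarrow>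
                elementary_divisor_ring (image_plus_ideal A B f J) \<and>
                f ` carrier A \<inter> J = {\<zero>\<^bsub>B\<^esub>}))) \<and>
         (\<not> inj_on f (carrier A) \<longrightarrow>
            (elementary_divisor_ring (amalgamation A B f J) \<longleftrightarrow>
              (J = {\<zero>\<^bsub>B\<^esub>} \<and> elementary_divisor_ring A) \<or>
              (J = carrier B \<and> elementary_divisor_ring A \<and> elementary_divisor_ring B)))"
proof -
  interpret A: domain A by fact
  interpret B: domain B by fact
  interpret J: ideal J B by fact
  interpret amalgamation_data A B f J
    using assms by unfold_locales
  let ?R = "amalgamation A B f J" and ?S = "image_plus_ideal A B f J"
  note imp_top = elementary_divisor_ring_amalg_imp_top[OF assms(1,2)]
  have zero: "\<zero>\<^bsub>B\<^esub> \<in> J"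
    by (rule J.zero_closed)
  have disjoint: "f ` carrier A \<inter> J = {\<zero>\<^bsub>B\<^esub>}"
    if R: "elementary_divisor_ring ?R" and "J \<noteq> carrier B"
  proof (rule ccontr)
    assume "f ` carrier A \<inter> J \<noteq> {\<zero>\<^bsub>B\<^esub>}"
    moreover have "\<zero>\<^bsub>B\<^esub> \<in> f ` carrier A \<inter> J"
      using zero A.zero_closed by (metis IntI hom_zero imageI)
    ultimately obtain a where "a \<in> carrier A" "f a \<in> J" "f a \<noteq> \<zero>\<^bsub>B\<^esub>"
      by blast
    moreover from this have "a \<noteq> \<zero>\<^bsub>A\<^esub>"
      by auto
    \<comment> \<open>The element \<open>f a\<close> plays two roles: it witnesses that
      \<open>a\<close> lies in the preimage of \<open>J\<close>, and it is the nonzero element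
      \<open>b\<close> of \<open>J\<close>.\<close>
    ultimately show False
      using imp_top[OF R] that(2) by blast
  qed
  have zero_or_top: "J = {\<zero>\<^bsub>B\<^esub>} \<or> J = carrier B"
    if R: "elementary_divisor_ring ?R" and not_inj: "\<not> inj_on f (carrier A)"
  proof -
    obtain a where a: "a \<in> carrier A" "f a = \<zero>\<^bsub>B\<^esub>" "a \<noteq> \<zero>\<^bsub>A\<^esub>"
    proof -
      obtain x y where xy: "x \<in> carrier A" "y \<in> carrier A" "f x = f y" "x \<noteq> y"
        using not_inj by (auto simp: inj_on_def)
      \<comment> \<open>The difference of two distinct points with equal images is a nonzero kernel
        element.\<close>
      then have "f (x \<ominus>\<^bsub>A\<^esub> y) = \<zero>\<^bsub>B\<^esub>"
        by (simp add: A.minus_eq B.r_neg)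
      then show thesis
        using that[of "x \<ominus>\<^bsub>A\<^esub> y"] xy by simp
    qed
    \<comment> \<open>The kernel element \<open>a\<close> lies in the preimage of any ideal, so a
      nonzero \<open>b\<close> in \<open>J\<close> would already force \<open>J\<close> to be all of
      \<open>B\<close>.\<close>
    have "b = \<zero>\<^bsub>B\<^esub>" if "b \<in> J" "J \<noteq> carrier B" for b
      using imp_top[OF R a(1,3) _ that(1)] that(2) zero a(2) by auto
    with zero show ?thesis
      by blast
  qed
  show ?thesis
  proof (intro conjI impI)
    assume "J = carrier B"
    then show "elementary_divisor_ring ?R \<longleftrightarrow> elementary_divisor_ring A \<and> elementary_divisor_ring B"
      by (rule elementary_divisor_ring_amalg_top_iff)
  next
    assume "inj_on f (carrier A)" "J \<noteq> carrier B"
    then show "elementary_divisor_ring ?R \<longleftrightarrow>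
        elementary_divisor_ring ?S \<and> f ` carrier A \<inter> J = {\<zero>\<^bsub>B\<^esub>}"
      \<comment> \<open>Left to right, \<open>disjoint\<close> provides the trivial intersection;
        once it is available, the isomorphism with \<open>f(A) + J\<close> settles both
        directions.\<close>
      using disjoint elementary_divisor_ring_amalg_inj_iff by metis
  next
    assume "\<not> inj_on f (carrier A)"
    then show "elementary_divisor_ring ?R \<longleftrightarrow>
        J = {\<zero>\<^bsub>B\<^esub>} \<and> elementary_divisor_ring A \<or>
        J = carrier B \<and> elementary_divisor_ring A \<and> elementary_divisor_ring B"
      using zero_or_top elementary_divisor_ring_amalg_top_iff elementary_divisor_ring_amalg_zero_iff
      by metis
  qed
qed

end
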